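(* Let $P$ be the transition kernel of lazy random walk $X$ on a finite connected graph $\mathcal{G}$ with stationary distribution $\pi$, and let $\lambda_0$ be the second largest eigenvalue of $P$. Assume $\lambda_0 \ge \tfrac12$ and fix $S \subseteq V(\mathcal{G})$. For $C_0 = 1/50$ and all integers $t\ge 0$, we have \[ \mathbf{P}_\pi\left[ \mathcal{L}_S(t) \le t\, \frac{\pi(S)}{2}\right] \le \exp\left(-C_0\, t\, \frac{\pi(S)}{t_{\mathrm{rel}}(\mathcal{G})}\right). \]
   Context: Lazy random walk on $\mathcal{G}$ is the Markov chain with transition matrix $P(x,x) = 1/2$, $P(x,y) = \frac{1}{2 d(x)}$ if $\{x,y\}$ is an edge, $P(x,y)=0$ otherwise, where $d(x)$ is the degree of $x$. $\mathbf{P}_\pi$ is the law of $X$ when $X(0)$ has distribution $\pi$. $\mathcal{L}_S(t) = \sum_{s=0}^t \mathbf{1}_{\{X(s)\in S\}}$ is the local time of $X$ in $S$. $t_{\mathrm{rel}}(\mathcal{G}) = \frac{1}{1-\lambda_0}$. *)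

theory Defs
  imports
    "HOL-Probability.Probability"
    "Graph_Theory.Digraph_Component"
    "Jordan_Normal_Form.Char_Poly"
begin

(* Graphs are those of the locale graph (finite, simple, undirected): every edge {x, y} is
   represented by the two arcs x -> y and y -> x, so out_degree G x is the degree d(x). *)

definition lazy_walk_kernel :: "('a, 'b) pre_digraph \<Rightarrow> 'a \<Rightarrow> 'a \<Rightarrow> real" where
  "lazy_walk_kernel G x y =
     (if x = y then 1 / 2
      else if x \<rightarrow>\<^bsub>G\<^esub> y then 1 / (2 * real (out_degree G x))
      else 0)"

definition stationary_distribution :: "'a set \<Rightarrow> ('a \<Rightarrow> 'a \<Rightarrow> real) \<Rightarrow> 'a pmf \<Rightarrow> bool" where
  "stationary_distribution V P \<pi> \<longleftrightarrow>
     set_pmf \<pi> \<subseteq> V \<and> (\<forall>y\<in>V. (\<Sum>x\<in>V. pmf \<pi> x * P x y) = pmf \<pi> y)"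

(* The enumeration of V is arbitrary: another one conjugates the matrix by a permutation
   matrix, which does not change the characteristic polynomial. *)
definition kernel_matrix :: "'a set \<Rightarrow> ('a \<Rightarrow> 'a \<Rightarrow> real) \<Rightarrow> real Matrix.mat" where
  "kernel_matrix V P =
     (let vs = (SOME vs. distinct vs \<and> set vs = V)
      in Matrix.mat (card V) (card V) (\<lambda>(i, j). P (vs ! i) (vs ! j)))"

definition eigenvalues_desc :: "'a set \<Rightarrow> ('a \<Rightarrow> 'a \<Rightarrow> real) \<Rightarrow> real list" where
  "eigenvalues_desc V P = rev (sorted_list_of_multiset (proots (char_poly (kernel_matrix V P))))"

(* Eigenvalues are counted with multiplicity. The kernel of a lazy walk is reversible, so its
   characteristic polynomial splits over the reals and the list has length card V; the value
   is meaningful only if V has at least two elements. *)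
definition second_largest_eigenvalue :: "'a set \<Rightarrow> ('a \<Rightarrow> 'a \<Rightarrow> real) \<Rightarrow> real" where
  "second_largest_eigenvalue V P = eigenvalues_desc V P ! 1"

definition relaxation_time :: "('a, 'b) pre_digraph \<Rightarrow> real" where
  "relaxation_time G = 1 / (1 - second_largest_eigenvalue (verts G) (lazy_walk_kernel G))"

definition markov_chain ::
  "'w measure \<Rightarrow> 'a set \<Rightarrow> ('a \<Rightarrow> 'a \<Rightarrow> real) \<Rightarrow> 'a pmf \<Rightarrow> (nat \<Rightarrow> 'w \<Rightarrow> 'a) \<Rightarrow> bool" where
  "markov_chain M V P \<mu> X \<longleftrightarrow>
     prob_space M \<and>
     (\<forall>n. X n \<in> measurable M (count_space V)) \<and>
     (\<forall>x\<in>V. \<P>(\<omega> in M. X 0 \<omega> = x) = pmf \<mu> x) \<and>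
     (\<forall>n x. \<forall>y\<in>V. (\<forall>i\<le>n. x i \<in> V) \<longrightarrow> \<P>(\<omega> in M. \<forall>i\<le>n. X i \<omega> = x i) > 0 \<longrightarrow>
        \<P>(\<omega> in M. X (Suc n) \<omega> = y \<bar> \<forall>i\<le>n. X i \<omega> = x i) = P (x n) y)"

definition local_time :: "(nat \<Rightarrow> 'w \<Rightarrow> 'a) \<Rightarrow> 'a set \<Rightarrow> nat \<Rightarrow> 'w \<Rightarrow> real" where
  "local_time X S t \<omega> = (\<Sum>s\<le>t. indicator S (X s \<omega>))"

end

theory Submission
  imports Defs
begin

text \<open>The proof is the exponential moment method, with the spectral gap entering through a quadratic form.
Let \<open>\<gamma>\<close> be one minus the second largest eigenvalue and \<open>p\<close> the stationary mass of \<open>S\<close>. With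
\<open>e = exp (- \<gamma> / 4)\<close> on \<open>S\<close> and \<open>e = 1\<close> elsewhere, \<open>exp (- \<gamma> / 4 * local_time X S t)\<close> is the product of \<open>e\<close>
along the first \<open>t + 1\<close> positions, so its expectation arises by \<open>t\<close> applications of the operator
\<open>f \<mapsto> e * P f\<close> to \<open>e\<close> (\<open>feynman_kac_expectation\<close>). This operator is self-adjoint and, by laziness,
positive semidefinite in the space with weight \<open>\<pi> / e\<close>; hence its norm is controlled by its quadratic
form (\<open>feynman_kac_decay\<close>).

The form is at most \<open>1 - \<gamma> * p / 5\<close> times the squared norm (\<open>tilted_form_bound\<close>): the Poincare inequality
contracts the part of a function orthogonal to constants by \<open>1 - \<gamma>\<close>, while a function close to a
constant feels the discount \<open>e\<close> on \<open>S\<close>, in proportion to \<open>p\<close>. So the expectation is at most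
\<open>(1 - \<gamma> * p / 5) ^ t\<close>, and Markov's inequality gives the bound \<open>exp (t * \<gamma> * p * (1 / 8 - 1 / 5))\<close>, which is
better than the one claimed.

The Poincare inequality with the second largest root of the characteristic polynomial
(\<open>poincare_second_eigenvalue\<close>) comes from maximising the Rayleigh quotient over functions of mean zero:
the maximiser is an eigenfunction, and connectedness makes its eigenvalue less than 1. Connectedness
also identifies the given stationary distribution as the one proportional to the degree, for which
the walk is reversible (\<open>lazy_walk_chain\<close>).\<close>

section \<open>Reversible kernels on a finite set\<close>

definition kernel_op :: "'a set \<Rightarrow> ('a \<Rightarrow> 'a \<Rightarrow> real) \<Rightarrow> ('a \<Rightarrow> real) \<Rightarrow> 'a \<Rightarrow> real" where
  "kernel_op V P g x = (\<Sum>y\<in>V. P x y * g y)"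

text \<open>The value at \<open>x\<close> is the expectation of the product of \<open>e\<close> along the first \<open>n + 1\<close> positions of
the chain started at \<open>x\<close>, obtained by conditioning on the first step; the link to an actual chain is
\<open>feynman_kac_expectation\<close>.\<close>
primrec feynman_kac :: "'a set \<Rightarrow> ('a \<Rightarrow> 'a \<Rightarrow> real) \<Rightarrow> ('a \<Rightarrow> real) \<Rightarrow> nat \<Rightarrow> 'a \<Rightarrow> real" where
  "feynman_kac V P e 0 x = e x"
| "feynman_kac V P e (Suc n) x = e x * kernel_op V P (feynman_kac V P e n) x"

text \<open>The Cauchy-Schwarz inequality of a positive semidefinite form, reduced to the plane spanned by two
vectors. It is used for forms that may be degenerate, in particular with \<open>a = 0\<close>, where it yields
\<open>b = 0\<close>.\<close>
lemma discriminant_le_if_form_nonneg: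
  fixes a b c :: real
  assumes "\<And>s t. 0 \<le> a * s\<^sup>2 + 2 * b * s * t + c * t\<^sup>2"
  shows "b\<^sup>2 \<le> a * c"
proof -
  have a: "a \<ge> 0" using assms[of 1 0] by simp
  have c: "c \<ge> 0" using assms[of 0 1] by simp
  consider "a > 0" | "c > 0" | "a = 0" "c = 0" using a c by linarith
  then show ?thesis
  proof cases
    \<comment> \<open>the arguments minimise the form along a line, so the form there is a multiple of \<open>a * c - b\<^sup>2\<close>\<close>
    case 1
    have "0 \<le> a * (a * c - b\<^sup>2)" using assms[of b "-a"] by (simp add: power2_eq_square algebra_simps)
    then show ?thesis using 1 by (simp add: zero_le_mult_iff)
  next
    case 2
    have "0 \<le> c * (a * c - b\<^sup>2)" using assms[of c "-b"] by (simp add: power2_eq_square algebra_simps)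
    then show ?thesis using 2 by (simp add: zero_le_mult_iff)
  next
    case 3
    then show ?thesis using assms[of 1 "-b"] by (simp add: power2_eq_square)
  qed
qed

locale reversible_kernel =
  fixes V :: "'a set" and P :: "'a \<Rightarrow> 'a \<Rightarrow> real" and w :: "'a \<Rightarrow> real"
  assumes finite_V: "finite V"
    and weight_pos: "x \<in> V \<Longrightarrow> 0 < w x"
    and kernel_nonneg: "x \<in> V \<Longrightarrow> y \<in> V \<Longrightarrow> 0 \<le> P x y"
    and row_sum: "x \<in> V \<Longrightarrow> (\<Sum>y\<in>V. P x y) = 1"
    and reversible: "x \<in> V \<Longrightarrow> y \<in> V \<Longrightarrow> w x * P x y = w y * P y x"
    and irreducible: "x \<in> V \<Longrightarrow> y \<in> V \<Longrightarrow> (x, y) \<in> {(x, y). x \<in> V \<and> y \<in> V \<and> 0 < P x y}\<^sup>*"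
begin

abbreviation avg :: "('a \<Rightarrow> real) \<Rightarrow> 'a \<Rightarrow> real" where
  "avg \<equiv> kernel_op V P"

definition ip :: "('a \<Rightarrow> real) \<Rightarrow> ('a \<Rightarrow> real) \<Rightarrow> real" where
  "ip f g = (\<Sum>x\<in>V. w x * f x * g x)"

definition mean :: "('a \<Rightarrow> real) \<Rightarrow> real" where
  "mean f = (\<Sum>x\<in>V. w x * f x)"

lemma avg_linear: "avg (\<lambda>x. a * f x + b * g x) = (\<lambda>x. a * avg f x + b * avg g x)"
  by (simp add: kernel_op_def fun_eq_iff sum.distrib sum_distrib_left algebra_simps)

lemma ip_linear_left: "ip (\<lambda>x. a * f x + b * g x) h = a * ip f h + b * ip g h"
  by (simp add: ip_def sum.distrib sum_distrib_left algebra_simps)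

lemma ip_commute: "ip f g = ip g f"
  by (simp add: ip_def mult_ac)

lemma ip_linear_right: "ip h (\<lambda>x. a * f x + b * g x) = a * ip h f + b * ip h g"
  by (simp add: ip_commute[of h] ip_linear_left)

lemma mean_linear: "mean (\<lambda>x. a * f x + b * g x) = a * mean f + b * mean g"
  by (simp add: mean_def sum.distrib sum_distrib_left algebra_simps)

lemma ip_avg_double_sum: "ip f (avg g) = (\<Sum>x\<in>V. \<Sum>y\<in>V. w x * P x y * f x * g y)"
  by (simp add: ip_def kernel_op_def sum_distrib_left mult_ac)

lemma avg_self_adjoint: "ip f (avg g) = ip (avg f) g"
proof -
  have "ip f (avg g) = (\<Sum>y\<in>V. \<Sum>x\<in>V. w x * P x y * f x * g y)"
    unfolding ip_avg_double_sum by (rule sum.swap)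
  also have "\<dots> = (\<Sum>y\<in>V. \<Sum>x\<in>V. w y * P y x * g y * f x)"
    by (intro sum.cong refl) (simp add: reversible)
  also have "\<dots> = ip g (avg f)" by (simp add: ip_avg_double_sum)
  finally show ?thesis by (simp add: ip_commute)
qed

lemma ip_self_nonneg: "0 \<le> ip f f"
  unfolding ip_def by (intro sum_nonneg) (simp add: weight_pos less_imp_le mult.assoc)

lemma ip_self_eq_0: "ip f f = 0 \<Longrightarrow> x \<in> V \<Longrightarrow> f x = 0"
proof -
  assume 0: "ip f f = 0" and x: "x \<in> V"
  have "\<forall>x\<in>V. w x * f x * f x = 0"
    using 0 unfolding ip_def
    by (subst (asm) sum_nonneg_eq_0_iff) (auto simp: finite_V weight_pos less_imp_le mult.assoc)
  then show "f x = 0" using weight_pos[OF x] x by auto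
qed

text \<open>Summation over the edges, where the weight \<open>w x * P x y\<close> has both marginals equal to \<open>w\<close>. The
choice \<open>s = -1\<close> is the Dirichlet form, which detects non-constant functions; the choice \<open>s = 1\<close>
expresses positivity of lazy chains.\<close>
lemma edge_energy:
  "(\<Sum>x\<in>V. \<Sum>y\<in>V. w x * P x y * (f x + s * f y)\<^sup>2) = (1 + s\<^sup>2) * ip f f + 2 * s * ip f (avg f)"
proof -
  have 1: "(\<Sum>x\<in>V. \<Sum>y\<in>V. w x * P x y * (f x)\<^sup>2) = ip f f"
  proof -
    have "(\<Sum>x\<in>V. \<Sum>y\<in>V. w x * P x y * (f x)\<^sup>2) = (\<Sum>x\<in>V. w x * (f x)\<^sup>2 * (\<Sum>y\<in>V. P x y))"
      unfolding sum_distrib_left by (simp add: mult_ac)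
    then show ?thesis by (simp add: row_sum ip_def power2_eq_square mult_ac)
  qed
  have "(\<Sum>x\<in>V. \<Sum>y\<in>V. w x * P x y * (f y)\<^sup>2) = (\<Sum>y\<in>V. \<Sum>x\<in>V. w x * P x y * (f y)\<^sup>2)"
    by (rule sum.swap)
  also have "\<dots> = (\<Sum>y\<in>V. \<Sum>x\<in>V. w y * P y x * (f y)\<^sup>2)"
    by (intro sum.cong refl) (simp add: reversible)
  finally have 2: "(\<Sum>x\<in>V. \<Sum>y\<in>V. w x * P x y * (f y)\<^sup>2) = ip f f" by (simp add: 1)
  have "(\<Sum>x\<in>V. \<Sum>y\<in>V. w x * P x y * (f x + s * f y)\<^sup>2) =
      (\<Sum>x\<in>V. \<Sum>y\<in>V. w x * P x y * (f x)\<^sup>2) + s\<^sup>2 * (\<Sum>x\<in>V. \<Sum>y\<in>V. w x * P x y * (f y)\<^sup>2)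
      + 2 * s * (\<Sum>x\<in>V. \<Sum>y\<in>V. w x * P x y * f x * f y)"
    by (simp add: sum_distrib_left flip: sum.distrib)
       (intro sum.cong refl, simp add: power2_eq_square algebra_simps)
  then show ?thesis unfolding 1 2 ip_avg_double_sum by (simp add: algebra_simps)
qed

lemma ip_avg_le: "ip f (avg f) \<le> ip f f"
proof -
  have "0 \<le> (\<Sum>x\<in>V. \<Sum>y\<in>V. w x * P x y * (f x + (-1) * f y)\<^sup>2)"
    by (intro sum_nonneg mult_nonneg_nonneg) (auto simp: weight_pos kernel_nonneg less_imp_le)
  then show ?thesis unfolding edge_energy by simp
qed

text \<open>The Dirichlet energy of \<open>f\<close> is zero, so \<open>f\<close> does not change along an edge, and irreducibility
propagates this to any two states.\<close>
lemma constant_if_ip_avg_eq: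
  assumes "ip f (avg f) = ip f f" and "x \<in> V" "y \<in> V"
  shows "f x = f y"
proof -
  have "(\<Sum>x\<in>V. \<Sum>y\<in>V. w x * P x y * (f x + (-1) * f y)\<^sup>2) = 0"
    unfolding edge_energy using assms(1) by simp
  then have zero: "\<forall>x\<in>V. (\<Sum>y\<in>V. w x * P x y * (f x - f y)\<^sup>2) = 0"
    by (subst (asm) sum_nonneg_eq_0_iff)
       (auto intro!: sum_nonneg mult_nonneg_nonneg simp: finite_V weight_pos kernel_nonneg less_imp_le)
  then have step: "f x = f y" if "x \<in> V" "y \<in> V" "P x y > 0" for x y
  proof -
    have "w x * P x y * (f x - f y)\<^sup>2 \<le> (\<Sum>y\<in>V. w x * P x y * (f x - f y)\<^sup>2)"
      using that by (intro member_le_sum mult_nonneg_nonneg)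
        (auto simp: finite_V weight_pos kernel_nonneg less_imp_le)
    also have "\<dots> = 0" using zero that by blast
    finally show ?thesis
      using that weight_pos[of x] by (simp add: mult_le_0_iff not_le)
  qed
  from irreducible[OF assms(2,3)] show ?thesis
    by induction (auto dest: step)
qed

lemma harmonic_constant:
  assumes "\<And>x. x \<in> V \<Longrightarrow> avg f x = f x" and "x \<in> V" "y \<in> V"
  shows "f x = f y"
proof (rule constant_if_ip_avg_eq[OF _ assms(2,3)])
  show "ip f (avg f) = ip f f" unfolding ip_def by (intro sum.cong) (auto simp: assms(1))
qed

text \<open>By reversibility the density of a stationary measure with respect to \<open>w\<close> is a harmonic function,
hence constant. This is the uniqueness of the stationary distribution.\<close>
lemma stationary_proportional:
  assumes "\<And>y. y \<in> V \<Longrightarrow> (\<Sum>x\<in>V. m x * P x y) = m y" and "x \<in> V" "y \<in> V"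
  shows "m x / w x = m y / w y"
proof (rule harmonic_constant[OF _ assms(2,3)])
  fix y assume y: "y \<in> V"
  have "w y * avg (\<lambda>x. m x / w x) y = (\<Sum>x\<in>V. m x * P x y)"
    unfolding kernel_op_def sum_distrib_left
  proof (intro sum.cong refl)
    fix x assume x: "x \<in> V"
    have "w y * (P y x * (m x / w x)) = w x * P x y * (m x / w x)"
      using reversible[OF x y] by (simp add: mult_ac)
    then show "w y * (P y x * (m x / w x)) = m x * P x y"
      using weight_pos[OF x] by (simp add: mult_ac)
  qed
  with assms(1)[OF y] show "avg (\<lambda>x. m x / w x) y = m y / w y"
    using weight_pos[OF y] by (simp add: field_simps)
qed

end

section \<open>The spectral gap as a Poincare inequality\<close>

locale reversible_chain = reversible_kernel +
  assumes weight_sum: "(\<Sum>x\<in>V. w x) = 1"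
begin

lemma mean_const: "mean (\<lambda>_. c) = c"
  by (simp add: mean_def weight_sum flip: sum_distrib_right)

lemma mean_avg: "mean (avg f) = mean f"
proof -
  have "mean (avg f) = ip (\<lambda>_. 1) (avg f)" by (simp add: mean_def ip_def)
  also have "\<dots> = ip (avg (\<lambda>_. 1)) f" by (rule avg_self_adjoint)
  also have "\<dots> = mean f"
    unfolding mean_def ip_def by (intro sum.cong refl) (simp add: kernel_op_def row_sum)
  finally show ?thesis .
qed

lemma ip_centred: 
  assumes f': "\<And>x. x \<in> V \<Longrightarrow> f' x = f x - mean f"
  shows "mean f' = 0" "ip f' f' = ip f f - (mean f)\<^sup>2" "ip f' (avg f') = ip f (avg f) - (mean f)\<^sup>2"
proof -
  have m: "mean f' = mean (\<lambda>x. 1 * f x + (-1) * mean f)"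
    unfolding mean_def by (intro sum.cong refl) (simp add: f' mean_def)
  also have "\<dots> = 0" by (simp only: mean_linear) (simp add: mean_const)
  finally show "mean f' = 0" .
  have "ip f' f' = (\<Sum>x\<in>V. w x * f x * f x - 2 * mean f * (w x * f x) + (mean f)\<^sup>2 * w x)"
    unfolding ip_def by (intro sum.cong refl) (simp add: f' algebra_simps power2_eq_square)
  also have "\<dots> = ip f f - 2 * mean f * mean f + (mean f)\<^sup>2"
    by (simp add: sum.distrib sum_subtractf weight_sum ip_def mean_def flip: sum_distrib_left)
  finally show "ip f' f' = ip f f - (mean f)\<^sup>2" by (simp add: power2_eq_square)
  have a: "avg f' x = avg f x - mean f" if "x \<in> V" for x
  proof -
    have "avg f' x = (\<Sum>y\<in>V. P x y * f y - P x y * mean f)"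
      unfolding kernel_op_def by (intro sum.cong refl) (simp add: f' algebra_simps)
    then show ?thesis by (simp add: sum_subtractf kernel_op_def row_sum that flip: sum_distrib_right)
  qed
  have "ip f' (avg f') = (\<Sum>x\<in>V. w x * f x * avg f x - mean f * (w x * f x) - mean f * (w x * avg f x) + (mean f)\<^sup>2 * w x)"
    unfolding ip_def by (intro sum.cong refl) (simp add: f' a algebra_simps power2_eq_square)
  also have "\<dots> = ip f (avg f) - mean f * mean f - mean f * mean (avg f) + (mean f)\<^sup>2"
    by (simp add: sum.distrib sum_subtractf weight_sum ip_def mean_def flip: sum_distrib_left)
  finally show "ip f' (avg f') = ip f (avg f) - (mean f)\<^sup>2" by (simp add: power2_eq_square mean_avg)
qed

text \<open>Functions that vanish outside of \<open>V\<close> and have norm one lie in a product of compact intervals, which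
is compact by Tychonoff's theorem, and all the conditions are closed.\<close>
lemma compact_centred_sphere:
  "compact {g. (\<forall>x. x \<notin> V \<longrightarrow> g x = 0) \<and> mean g = 0 \<and> ip g g = 1}" (is "compact ?K")
proof -
  \<comment> \<open>from \<open>w x * (g x)\<^sup>2 \<le> 1\<close> and \<open>\<bar>g x\<bar> \<le> 1 + (g x)\<^sup>2\<close>\<close>
  define c where "c x = (if x \<in> V then 1 + 1 / w x else 0)" for x
  have box: "compact (PiE UNIV (\<lambda>x. {- c x..c x}))"
    using compactin_PiE[of "\<lambda>_. euclidean" UNIV "\<lambda>x. {- c x..c x}"]
    by (simp add: euclidean_product_topology)
  have sub: "?K \<subseteq> PiE UNIV (\<lambda>x. {- c x..c x})"
  proof (intro subsetI PiE_I)
    fix g x assume g: "g \<in> ?K"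
    show "g x \<in> {- c x..c x}"
    proof (cases "x \<in> V")
      case True
      have "w x * g x * g x \<le> ip g g"
        unfolding ip_def using True
        by (intro member_le_sum) (auto simp: finite_V weight_pos less_imp_le mult.assoc)
      then have "(g x)\<^sup>2 \<le> 1 / w x"
        using g weight_pos[OF True] by (simp add: field_simps power2_eq_square)
      moreover have "\<bar>g x\<bar> \<le> 1 + (g x)\<^sup>2"
        using zero_le_power2[of "\<bar>g x\<bar> - 1"] zero_le_power2[of "g x"] by (simp add: power2_diff)
      ultimately show ?thesis using True by (auto simp: c_def)
    qed (use g in \<open>auto simp: c_def\<close>)
  qed auto
  have cont: "continuous_on UNIV (\<lambda>g::'a \<Rightarrow> real. g x)" for x
    by (rule continuous_on_product_coordinates)
  have "?K = (\<Inter>x\<in>-V. {g. g x = 0}) \<inter> {g. mean g = 0} \<inter> {g. ip g g = 1}" by auto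
  also have "closed \<dots>"
    unfolding mean_def ip_def
    by (intro closed_Int closed_INT ballI closed_Collect_eq continuous_intros cont)
  finally have "closed ?K" .
  from compact_Int_closed[OF box this] show ?thesis using sub by (simp only: Int_absorb1)
qed

lemma centred_sphere_nonempty:
  assumes "card V \<ge> 2"
  shows "{g. (\<forall>x. x \<notin> V \<longrightarrow> g x = 0) \<and> mean g = 0 \<and> ip g g = 1} \<noteq> {}"
proof -
  obtain a b where ab: "a \<in> V" "b \<in> V" "a \<noteq> b"
    using assms card_le_Suc0_iff_eq[OF finite_V] by fastforce
  define g where "g x = (if x = a then 1 / w a else 0) - (if x = b then 1 / w b else 0)" for x
  have "mean g = (\<Sum>x\<in>V. (if x = a then 1 else 0) - (if x = b then 1 else 0))"
    unfolding mean_def using weight_pos[of a] weight_pos[of b] ab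
    by (intro sum.cong refl) (auto simp: g_def)
  then have m: "mean g = 0" using ab by (simp add: sum_subtractf finite_V)
  have "g a \<noteq> 0" using ab weight_pos[of a] by (simp add: g_def)
  then have pos: "ip g g > 0" using ip_self_eq_0[of g a] ip_self_nonneg[of g] ab by linarith
  define k where "k = 1 / sqrt (ip g g)"
  have "mean (\<lambda>x. k * g x) = k * mean g" by (simp add: mean_def sum_distrib_left mult_ac)
  moreover have "ip (\<lambda>x. k * g x) (\<lambda>x. k * g x) = k * k * ip g g"
    by (simp add: ip_def sum_distrib_left mult_ac)
  moreover have "k * k * ip g g = 1" using pos by (simp add: k_def field_simps)
  moreover have "\<forall>x. x \<notin> V \<longrightarrow> k * g x = 0" using ab by (auto simp: g_def)
  ultimately have "(\<lambda>x. k * g x) \<in> {g. (\<forall>x. x \<notin> V \<longrightarrow> g x = 0) \<and> mean g = 0 \<and> ip g g = 1}"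
    using m by simp
  then show ?thesis by (intro notI) (simp only: empty_iff)
qed

text \<open>The constant \<open>\<mu>\<close> is the maximum of the Rayleigh quotient over functions of mean zero. The form \<open>C\<close>
of the proof is positive semidefinite by maximality and vanishes on the maximiser \<open>g\<close>, so by
Cauchy-Schwarz it vanishes on all pairs \<open>g, d\<close>; testing with point masses \<open>d\<close> gives the eigenvalue
equation. If \<open>\<mu>\<close> were 1, then \<open>g\<close> would have no Dirichlet energy, thus be a constant of mean zero,
which contradicts its normalisation. In this way the inequality for the second eigenvalue is obtained
without diagonalising the kernel.\<close>
lemma poincare_eigenfunction:
  assumes card: "card V \<ge> 2"
  obtains \<mu> g where "\<mu> < 1" "\<exists>x\<in>V. g x \<noteq> 0" "\<And>x. x \<in> V \<Longrightarrow> avg g x = \<mu> * g x"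
    "\<And>f. ip f (avg f) - (mean f)\<^sup>2 \<le> \<mu> * (ip f f - (mean f)\<^sup>2)"
proof -
  let ?K = "{g. (\<forall>x. x \<notin> V \<longrightarrow> g x = 0) \<and> mean g = 0 \<and> ip g g = 1}"
  have cont: "continuous_on UNIV (\<lambda>g::'a \<Rightarrow> real. g x)" for x
    by (rule continuous_on_product_coordinates)
  have "continuous_on ?K (\<lambda>g. ip g (avg g))"
    unfolding ip_avg_double_sum
    by (intro continuous_intros continuous_on_subset[OF cont]) auto
  from continuous_attains_sup[OF compact_centred_sphere centred_sphere_nonempty[OF card] this]
  obtain g where gK: "g \<in> ?K" and max: "\<And>f. f \<in> ?K \<Longrightarrow> ip f (avg f) \<le> ip g (avg g)" by blast
  define \<mu> where "\<mu> = ip g (avg g)"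
  from gK have g: "mean g = 0" "ip g g = 1" by auto
  have bound: "ip f (avg f) - (mean f)\<^sup>2 \<le> \<mu> * (ip f f - (mean f)\<^sup>2)" for f
  proof -
    define h where "h x = (if x \<in> V then f x - mean f else 0)" for x
    have h: "mean h = 0" "ip h h = ip f f - (mean f)\<^sup>2" "ip h (avg h) = ip f (avg f) - (mean f)\<^sup>2"
      by (rule ip_centred; simp add: h_def)+
    have "ip h (avg h) \<le> \<mu> * ip h h"
    proof (cases "ip h h = 0")
      case True
      then have "h x = 0" if "x \<in> V" for x using ip_self_eq_0 that by blast
      then have "ip h (avg h) = 0" by (simp add: ip_def)
      then show ?thesis using True by simp
    next
      case False
      then have pos: "ip h h > 0" using ip_self_nonneg[of h] by linarith
      define k where "k = 1 / sqrt (ip h h)"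
      have kk: "k * k * ip h h = 1" using pos by (simp add: k_def field_simps)
      have "mean (\<lambda>x. k * h x) = k * mean h" by (simp add: mean_def sum_distrib_left mult_ac)
      moreover have "ip (\<lambda>x. k * h x) (\<lambda>x. k * h x) = k * k * ip h h"
        by (simp add: ip_def sum_distrib_left mult_ac)
      ultimately have "(\<lambda>x. k * h x) \<in> ?K" using h kk by (simp add: h_def)
      from max[OF this] have "k * k * ip h (avg h) \<le> \<mu>"
        by (simp add: \<mu>_def ip_avg_double_sum sum_distrib_left mult_ac)
      then have "ip h h * (k * k * ip h (avg h)) \<le> ip h h * \<mu>" using pos by simp
      also have "ip h h * (k * k * ip h (avg h)) = (k * k * ip h h) * ip h (avg h)" by simp
      finally show ?thesis unfolding kk by (simp only: mult_1 mult.commute)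
    qed
    then show ?thesis by (simp add: h)
  qed
  have eig: "avg g z = \<mu> * g z" if z: "z \<in> V" for z
  proof -
    define d where "d x = (if x = z then 1 else 0 :: real)" for x
    define C where "C f h = \<mu> * (ip f h - mean f * mean h) - (ip f (avg h) - mean f * mean h)" for f h
    have sym: "C f h = C h f" for f h
      unfolding C_def using avg_self_adjoint[of f h] ip_commute[of "avg f" h] ip_commute[of f h]
      by (simp add: mult_ac)
    have "0 \<le> C (\<lambda>x. s * g x + t * d x) (\<lambda>x. s * g x + t * d x)" for s t
      unfolding C_def using bound[of "\<lambda>x. s * g x + t * d x"] by (simp add: power2_eq_square)
    moreover have "C (\<lambda>x. s * g x + t * d x) (\<lambda>x. s * g x + t * d x)
        = C g g * s\<^sup>2 + (C g d + C d g) * s * t + C d d * t\<^sup>2" for s t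
      unfolding C_def avg_linear ip_linear_left ip_linear_right mean_linear
      by (simp add: power2_eq_square algebra_simps)
    ultimately have "(C g d)\<^sup>2 \<le> C g g * C d d"
      by (intro discriminant_le_if_form_nonneg) (simp add: sym[of d g])
    moreover have "C g g = 0" by (simp add: C_def g \<mu>_def)
    ultimately have "C g d = 0" by simp
    then have "\<mu> * ip g d = ip (avg g) d" by (simp add: C_def g avg_self_adjoint)
    moreover have "ip f d = w z * f z" for f
      using z by (simp add: ip_def d_def finite_V if_distrib cong: if_cong)
    ultimately show ?thesis using weight_pos[OF z] by simp
  qed
  have nz: "\<exists>x\<in>V. g x \<noteq> 0"
  proof (rule ccontr)
    assume "\<not> ?thesis"
    then have "ip g g = 0" by (simp add: ip_def)
    with g show False by simp
  qed
  have "\<mu> < 1"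
  proof (rule ccontr)
    assume "\<not> \<mu> < 1"
    moreover have "\<mu> \<le> 1" using ip_avg_le[of g] by (simp add: \<mu>_def g)
    ultimately have "ip g (avg g) = ip g g" by (simp add: \<mu>_def g)
    then have const: "g x = g y" if "x \<in> V" "y \<in> V" for x y
      using constant_if_ip_avg_eq that by blast
    obtain x where x: "x \<in> V" "g x \<noteq> 0" using nz by blast
    have "mean g = mean (\<lambda>_. g x)"
      unfolding mean_def by (intro sum.cong refl) (metis const x(1))
    with x g show False by (simp add: mean_const)
  qed
  from that[OF this nz eig bound] show thesis .
qed

end

lemma root_char_poly_kernel_matrix:
  fixes P :: "'a \<Rightarrow> 'a \<Rightarrow> real"
  assumes "finite V" and "\<exists>x\<in>V. g x \<noteq> 0" and eig: "\<And>x. x \<in> V \<Longrightarrow> kernel_op V P g x = \<mu> * g x"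
  shows "poly (char_poly (kernel_matrix V P)) \<mu> = 0"
proof -
  define vs where "vs = (SOME vs. distinct vs \<and> set vs = V)"
  have "\<exists>vs. distinct vs \<and> set vs = V" using finite_distinct_list[OF assms(1)] by blast
  then have vs: "distinct vs" "set vs = V" unfolding vs_def by (metis (mono_tags, lifting) someI_ex)+
  then have len: "length vs = card V" by (metis distinct_card)
  define A where "A = kernel_matrix V P"
  have A: "A = Matrix.mat (card V) (card V) (\<lambda>(i, j). P (vs ! i) (vs ! j))"
    by (simp add: A_def kernel_matrix_def vs_def Let_def)
  have carrier: "A \<in> carrier_mat (card V) (card V)" by (simp add: A)
  let ?v = "Matrix.vec (card V) (\<lambda>i. g (vs ! i))"
  obtain x where x: "x \<in> V" "g x \<noteq> 0" using assms(2) by blast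
  then obtain i where i: "i < card V" "vs ! i = x" using vs len by (metis in_set_conv_nth)
  have "?v \<noteq> 0\<^sub>v (card V)"
  proof
    assume "?v = 0\<^sub>v (card V)"
    then have "vec_index ?v i = vec_index (0\<^sub>v (card V)) i" by simp
    then show False using i x by simp
  qed
  moreover have "A *\<^sub>v ?v = \<mu> \<cdot>\<^sub>v ?v"
  proof (rule eq_vecI)
    fix i assume "i < dim_vec (\<mu> \<cdot>\<^sub>v ?v)"
    then have i: "i < card V" by simp
    have bij: "bij_betw ((!) vs) {0..<card V} V"
      by (rule bij_betw_nth[OF vs(1)]) (simp_all only: len vs(2) atLeast0LessThan)
    have "vec_index (A *\<^sub>v ?v) i = (\<Sum>j = 0..<card V. P (vs ! i) (vs ! j) * g (vs ! j))"
      using i by (simp add: A scalar_prod_def)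
    also have "\<dots> = kernel_op V P g (vs ! i)"
      unfolding kernel_op_def by (rule sum.reindex_bij_betw[OF bij])
    also have "\<dots> = \<mu> * g (vs ! i)" using eig vs i len by (metis nth_mem)
    finally show "vec_index (A *\<^sub>v ?v) i = vec_index (\<mu> \<cdot>\<^sub>v ?v) i" using i by simp
  qed (simp add: A)
  ultimately have "eigenvalue A \<mu>"
    unfolding eigenvalue_def eigenvector_def using carrier by (intro exI[of _ ?v]) auto
  then show ?thesis using eigenvalue_root_char_poly[OF carrier] by (simp add: A_def)
qed

text \<open>Of two distinct values, the smaller one cannot sit at the head of the descending list, so the entry
after the head bounds it.\<close>
lemma nth_1_sorted_desc_ge:
  fixes M :: "real multiset"
  assumes "\<mu> \<in># M" "\<nu> \<in># M" "\<mu> < \<nu>"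
  shows "\<mu> \<le> rev (sorted_list_of_multiset M) ! 1"
proof -
  define ys where "ys = sorted_list_of_multiset M"
  have s: "sorted ys" by (simp add: ys_def)
  have "set ys = set_mset M" by (simp add: ys_def)
  then obtain i j where ij: "i < length ys" "ys ! i = \<mu>" "j < length ys" "ys ! j = \<nu>"
    using assms by (metis in_set_conv_nth)
  have "i < j"
  proof (rule ccontr)
    assume "\<not> i < j"
    then have "ys ! j \<le> ys ! i" using sorted_nth_mono[OF s, of j i] ij by simp
    with ij assms show False by simp
  qed
  then have l: "i \<le> length ys - 2" "length ys - 2 < length ys" "1 < length ys" using ij by auto
  then have "\<mu> \<le> ys ! (length ys - 2)" using s ij(2) by (metis sorted_iff_nth_mono)
  also have "\<dots> = rev ys ! 1" using l by (simp add: rev_nth numeral_2_eq_2)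
  finally show ?thesis by (simp add: ys_def)
qed

lemma second_largest_eigenvalue_ge:
  fixes P :: "'a \<Rightarrow> 'a \<Rightarrow> real"
  assumes "finite V" and "\<mu> < \<nu>"
    and "poly (char_poly (kernel_matrix V P)) \<mu> = 0" "poly (char_poly (kernel_matrix V P)) \<nu> = 0"
  shows "\<mu> \<le> second_largest_eigenvalue V P"
proof -
  have "kernel_matrix V P \<in> carrier_mat (card V) (card V)" by (simp add: kernel_matrix_def Let_def)
  from degree_monic_char_poly[OF this] have "char_poly (kernel_matrix V P) \<noteq> 0"
    by (metis coeff_0 zero_neq_one)
  then show ?thesis
    unfolding second_largest_eigenvalue_def eigenvalues_desc_def
    using assms by (intro nth_1_sorted_desc_ge[of _ _ \<nu>]) auto
qed

context reversible_chain
begin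

text \<open>The maximiser of the Rayleigh quotient gives a root \<open>\<mu> < 1\<close> of the characteristic polynomial, and
constants give the root 1; so \<open>\<mu>\<close> is at most the second largest root, and a larger constant weakens
the Poincare inequality because variances are nonnegative.\<close>
lemma poincare_second_eigenvalue:
  assumes "card V \<ge> 2"
  shows "ip f (avg f) - (mean f)\<^sup>2 \<le> second_largest_eigenvalue V P * (ip f f - (mean f)\<^sup>2)"
proof -
  obtain \<mu> g where \<mu>: "\<mu> < 1" "\<exists>x\<in>V. g x \<noteq> 0" "\<And>x. x \<in> V \<Longrightarrow> avg g x = \<mu> * g x"
    and bound: "\<And>f. ip f (avg f) - (mean f)\<^sup>2 \<le> \<mu> * (ip f f - (mean f)\<^sup>2)"
    using poincare_eigenfunction[OF assms] by blast
  have "poly (char_poly (kernel_matrix V P)) 1 = 0"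
  proof (rule root_char_poly_kernel_matrix[OF finite_V])
    show "\<exists>x\<in>V. (1::real) \<noteq> 0" using assms by (cases "V = {}") auto
    show "avg (\<lambda>_. 1) x = 1 * 1" if "x \<in> V" for x using that by (simp add: kernel_op_def row_sum)
  qed
  then have "\<mu> \<le> second_largest_eigenvalue V P"
    using second_largest_eigenvalue_ge[OF finite_V \<mu>(1) root_char_poly_kernel_matrix[OF finite_V \<mu>(2,3)]]
    by blast
  moreover have "0 \<le> ip f f - (mean f)\<^sup>2"
    using ip_self_nonneg[of "\<lambda>x. f x - mean f"] ip_centred(2)[of "\<lambda>x. f x - mean f" f] by simp
  ultimately show ?thesis using bound[of f] by (meson mult_right_mono order_trans)
qed

end

section \<open>Decay of exponential functionals of a lazy chain\<close>

locale lazy_reversible_chain = reversible_chain +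
  assumes lazy: "x \<in> V \<Longrightarrow> 1 / 2 \<le> P x x"
begin

text \<open>The diagonal terms alone of the edge sum with \<open>s = 1\<close> are at least \<open>2 * ip f f\<close>, since half of the
mass stays in place.\<close>
lemma ip_avg_nonneg: "0 \<le> ip f (avg f)"
proof -
  have "2 * ip f f = (\<Sum>x\<in>V. 2 * (w x * f x * f x))" by (simp add: ip_def sum_distrib_left)
  also have "\<dots> \<le> (\<Sum>x\<in>V. \<Sum>y\<in>V. w x * P x y * (f x + 1 * f y)\<^sup>2)"
  proof (intro sum_mono)
    fix x assume x: "x \<in> V"
    have "2 * (w x * f x * f x) = w x * (1 / 2) * (f x + 1 * f x)\<^sup>2" by (simp add: power2_eq_square)
    also have "\<dots> \<le> w x * P x x * (f x + 1 * f x)\<^sup>2"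
      using lazy[OF x] weight_pos[OF x] by (intro mult_right_mono mult_left_mono) auto
    also have "\<dots> \<le> (\<Sum>y\<in>V. w x * P x y * (f x + 1 * f y)\<^sup>2)"
      using x by (intro member_le_sum[where f = "\<lambda>y. w x * P x y * (f x + 1 * f y)\<^sup>2"] mult_nonneg_nonneg)
        (auto simp: finite_V weight_pos kernel_nonneg less_imp_le)
    finally show "2 * (w x * f x * f x) \<le> (\<Sum>y\<in>V. w x * P x y * (f x + 1 * f y)\<^sup>2)" .
  qed
  also have "\<dots> = 2 * ip f f + 2 * ip f (avg f)" unfolding edge_energy by simp
  finally show ?thesis by simp
qed

lemma ip_avg_cauchy_schwarz: "(ip f (avg g))\<^sup>2 \<le> ip f (avg f) * ip g (avg g)"
proof (rule discriminant_le_if_form_nonneg)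
  fix s t :: real
  have "0 \<le> ip (\<lambda>x. s * f x + t * g x) (avg (\<lambda>x. s * f x + t * g x))" by (rule ip_avg_nonneg)
  also have "\<dots> = ip f (avg f) * s\<^sup>2 + (ip f (avg g) + ip g (avg f)) * s * t + ip g (avg g) * t\<^sup>2"
    unfolding avg_linear ip_linear_left ip_linear_right by (simp add: power2_eq_square algebra_simps)
  also have "ip g (avg f) = ip f (avg g)" by (simp add: avg_self_adjoint[of f g] ip_commute[of g])
  finally show "0 \<le> ip f (avg f) * s\<^sup>2 + 2 * ip f (avg g) * s * t + ip g (avg g) * t\<^sup>2" by simp
qed

text \<open>The operator in question is \<open>f \<mapsto> e * avg f\<close>, which is self-adjoint and positive semidefinite for
the inner product with weight \<open>w / e\<close>. For such an operator a bound \<open>\<rho>\<close> on the quadratic form is a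
bound on the operator norm; the step estimate for \<open>N\<close>, the squared norm, proves this through the
Cauchy-Schwarz inequality of the form itself. Starting from \<open>e\<close>, whose norm is at most one, \<open>n\<close>
applications lose a factor \<open>\<rho> ^ n\<close>, and the mean is the pairing with \<open>e\<close>.\<close>
lemma feynman_kac_decay:
  assumes e: "\<And>x. x \<in> V \<Longrightarrow> 0 < e x" "\<And>x. x \<in> V \<Longrightarrow> e x \<le> 1"
    and \<rho>: "0 \<le> \<rho>" and bound: "\<And>f. ip f (avg f) \<le> \<rho> * ip f (\<lambda>x. f x / e x)"
  shows "mean (feynman_kac V P e n) \<le> \<rho> ^ n"
proof -
  define u where "u = feynman_kac V P e"
  define N where "N f = ip f (\<lambda>x. f x / e x)" for f
  have N_nonneg: "0 \<le> N f" for f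
    unfolding N_def ip_def by (intro sum_nonneg) (auto simp: e weight_pos less_imp_le mult.assoc)
  have mean_e: "mean e \<le> 1"
  proof -
    have "mean e \<le> (\<Sum>x\<in>V. w x * 1)"
      unfolding mean_def by (intro sum_mono mult_left_mono) (auto simp: e weight_pos less_imp_le)
    then show ?thesis by (simp add: weight_sum)
  qed
  have N_step: "N (u (Suc n)) \<le> \<rho>\<^sup>2 * N (u n)" for n
  proof -
    have "N (u (Suc n)) = ip (u (Suc n)) (avg (u n))"
      unfolding N_def ip_def
    proof (intro sum.cong refl)
      fix x assume x: "x \<in> V"
      show "w x * u (Suc n) x * (u (Suc n) x / e x) = w x * u (Suc n) x * avg (u n) x"
        using e(1)[OF x] by (simp add: u_def)
    qed
    then have "(N (u (Suc n)))\<^sup>2 \<le> ip (u (Suc n)) (avg (u (Suc n))) * ip (u n) (avg (u n))"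
      using ip_avg_cauchy_schwarz by metis
    also have "\<dots> \<le> (\<rho> * N (u (Suc n))) * (\<rho> * N (u n))"
      unfolding N_def by (intro mult_mono bound ip_avg_nonneg)
        (use N_nonneg[unfolded N_def] \<rho> in auto)
    finally have "N (u (Suc n)) * N (u (Suc n)) \<le> N (u (Suc n)) * (\<rho>\<^sup>2 * N (u n))"
      by (simp add: power2_eq_square mult_ac)
    then show ?thesis
      using N_nonneg[of "u (Suc n)"] N_nonneg[of "u n"] by (cases "N (u (Suc n)) = 0") auto
  qed
  have N_bound: "N (u n) \<le> (\<rho>\<^sup>2) ^ n" for n
  proof (induction n)
    case 0
    have "N (u 0) = mean e"
      unfolding N_def ip_def mean_def by (intro sum.cong refl) (auto simp: u_def dest: e(1))
    then show ?case using mean_e by simp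
  next
    case (Suc n)
    have "N (u (Suc n)) \<le> \<rho>\<^sup>2 * N (u n)" by (rule N_step)
    also have "\<dots> \<le> \<rho>\<^sup>2 * (\<rho>\<^sup>2) ^ n" by (intro mult_left_mono Suc.IH) auto
    finally show ?case by simp
  qed
  have "(mean (u n))\<^sup>2 = (\<Sum>x\<in>V. sqrt (w x * e x) * (sqrt (w x / e x) * u n x))\<^sup>2"
    unfolding mean_def
  proof (intro arg_cong[of _ _ "\<lambda>s. s\<^sup>2"] sum.cong refl)
    fix x assume x: "x \<in> V"
    have "sqrt (w x * e x) * sqrt (w x / e x) = w x"
      using e(1)[OF x] weight_pos[OF x] by (simp flip: real_sqrt_mult)
    then show "w x * u n x = sqrt (w x * e x) * (sqrt (w x / e x) * u n x)" by (simp flip: mult.assoc)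
  qed
  also have "\<dots> \<le> (\<Sum>x\<in>V. (sqrt (w x * e x))\<^sup>2) * (\<Sum>x\<in>V. (sqrt (w x / e x) * u n x)\<^sup>2)"
    by (rule Cauchy_Schwarz_ineq_sum)
  also have "(\<Sum>x\<in>V. (sqrt (w x * e x))\<^sup>2) = mean e"
    unfolding mean_def by (intro sum.cong refl) (auto simp: e weight_pos less_imp_le)
  also have "(\<Sum>x\<in>V. (sqrt (w x / e x) * u n x)\<^sup>2) = N (u n)"
    unfolding N_def ip_def
    by (intro sum.cong refl)
       (auto simp: e weight_pos less_imp_le power_mult_distrib power2_eq_square[of "u n _"])
  also have "mean e * N (u n) \<le> 1 * (\<rho>\<^sup>2) ^ n"
    by (intro mult_mono mean_e N_bound N_nonneg) auto
  also have "\<dots> = (\<rho> ^ n)\<^sup>2" by (simp add: mult.commute flip: power_mult)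
  finally have "\<bar>mean (u n)\<bar> \<le> \<bar>\<rho> ^ n\<bar>" by (simp add: abs_le_square_iff)
  then show ?thesis using \<rho> by (simp add: u_def)
qed

text \<open>The Poincare inequality bounds the form by \<open>(1 - \<gamma>) * ip f f + \<gamma> * (mean f)\<^sup>2\<close>. A function for
which the second term is nearly \<open>\<gamma> * ip f f\<close> is nearly constant, hence not small on \<open>S\<close>, where the
tilted norm on the right charges extra mass. This is made quantitative by the Cauchy-Schwarz inequality
for the mean with weight \<open>m = 1 + indicator S / 4\<close>. The constants match: the mean of \<open>1 / m\<close> is exactly
\<open>1 - p / 5\<close>, so off \<open>S\<close> the pointwise coefficients on both sides agree, and on \<open>S\<close> they compare
through \<open>exp (\<gamma> / 4) \<ge> 1 + \<gamma> / 4\<close> and \<open>\<gamma> \<le> 1\<close>.\<close>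
lemma tilted_form_bound:
  assumes poincare: "\<And>f. ip f (avg f) - (mean f)\<^sup>2 \<le> (1 - \<gamma>) * (ip f f - (mean f)\<^sup>2)"
    and \<gamma>: "0 \<le> \<gamma>" "\<gamma> \<le> 1" and S: "S \<subseteq> V"
  defines "p \<equiv> sum w S"
  shows "ip f (avg f) \<le> (1 - \<gamma> * p / 5) * ip f (\<lambda>x. f x / exp (- (\<gamma> / 4 * indicator S x)))"
proof -
  have p: "0 \<le> p" "p \<le> 1"
    unfolding p_def using sum_nonneg[of S w] sum_mono2[OF finite_V S, of w] S weight_sum
    by (auto simp: weight_pos less_imp_le subset_eq)
  define m :: "'a \<Rightarrow> real" where "m x = 1 + indicator S x / 4" for x
  have m: "0 < m x" for x by (simp add: m_def indicator_def)
  have "(mean f)\<^sup>2 = (\<Sum>x\<in>V. sqrt (w x / m x) * (sqrt (w x * m x) * f x))\<^sup>2"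
    unfolding mean_def
  proof (intro arg_cong[of _ _ "\<lambda>s. s\<^sup>2"] sum.cong refl)
    fix x assume x: "x \<in> V"
    have "sqrt (w x / m x) * sqrt (w x * m x) = w x"
      using m[of x] weight_pos[OF x] by (simp flip: real_sqrt_mult)
    then show "w x * f x = sqrt (w x / m x) * (sqrt (w x * m x) * f x)" by (simp flip: mult.assoc)
  qed
  also have "\<dots> \<le> (\<Sum>x\<in>V. (sqrt (w x / m x))\<^sup>2) * (\<Sum>x\<in>V. (sqrt (w x * m x) * f x)\<^sup>2)"
    by (rule Cauchy_Schwarz_ineq_sum)
  also have "(\<Sum>x\<in>V. (sqrt (w x / m x))\<^sup>2) = (\<Sum>x\<in>V. w x - w x * indicator S x / 5)"
  proof (intro sum.cong refl)
    fix x assume x: "x \<in> V"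
    then have "(sqrt (w x / m x))\<^sup>2 = w x / m x" using m[of x] weight_pos[OF x] by simp
    then show "(sqrt (w x / m x))\<^sup>2 = w x - w x * indicator S x / 5"
      by (simp add: m_def indicator_def)
  qed
  also have "\<dots> = 1 - p / 5"
  proof -
    have "(\<Sum>x\<in>V. w x * indicator S x) = (\<Sum>x\<in>S. w x * indicator S x)"
      by (rule sum.mono_neutral_right[OF finite_V S]) auto
    then show ?thesis by (simp add: sum_subtractf weight_sum p_def flip: sum_divide_distrib)
  qed
  also have "(\<Sum>x\<in>V. (sqrt (w x * m x) * f x)\<^sup>2) = (\<Sum>x\<in>V. w x * m x * (f x)\<^sup>2)"
    by (intro sum.cong refl)
       (auto simp: m less_imp_le weight_pos power_mult_distrib)
  finally have mean: "(mean f)\<^sup>2 \<le> (1 - p / 5) * (\<Sum>x\<in>V. w x * m x * (f x)\<^sup>2)" .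
  have div_exp: "z / exp (- a) = z * exp a" for z a :: real
    by (simp add: exp_minus divide_inverse)
  have "ip f (avg f) \<le> (1 - \<gamma>) * ip f f + \<gamma> * (mean f)\<^sup>2"
    using poincare[of f] by (simp add: algebra_simps)
  also have "\<dots> \<le> (1 - \<gamma>) * ip f f + \<gamma> * ((1 - p / 5) * (\<Sum>x\<in>V. w x * m x * (f x)\<^sup>2))"
    using mean \<gamma> by (intro add_left_mono mult_left_mono)
  also have "\<dots> = (\<Sum>x\<in>V. w x * (f x)\<^sup>2 * (1 - \<gamma> + \<gamma> * (1 - p / 5) * m x))"
    unfolding ip_def sum_distrib_left sum.distrib[symmetric]
    by (intro sum.cong refl) (simp add: power2_eq_square algebra_simps)
  also have "\<dots> \<le> (\<Sum>x\<in>V. w x * (f x)\<^sup>2 * ((1 - \<gamma> * p / 5) * exp (\<gamma> / 4 * indicator S x)))"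
  proof (intro sum_mono mult_left_mono)
    fix x assume x: "x \<in> V"
    have \<gamma>p: "\<gamma> * p \<le> p" "0 \<le> \<gamma> * p" using p \<gamma> by (auto intro: mult_left_le_one_le)
    have "1 - \<gamma> + \<gamma> * (1 - p / 5) * m x \<le> (1 - \<gamma> * p / 5) * (1 + \<gamma> / 4 * indicator S x)"
    proof (cases "x \<in> S")
      case True
      have "\<gamma> * (1 - p / 5) \<le> \<gamma> * (1 - \<gamma> * p / 5)" using \<gamma>p \<gamma> by (intro mult_left_mono) auto
      then show ?thesis using True by (simp add: m_def algebra_simps)
    qed (simp add: m_def algebra_simps)
    also have "\<dots> \<le> (1 - \<gamma> * p / 5) * exp (\<gamma> / 4 * indicator S x)"
      using \<gamma>p p by (intro mult_left_mono exp_ge_add_one_self) auto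
    finally show "1 - \<gamma> + \<gamma> * (1 - p / 5) * m x \<le> (1 - \<gamma> * p / 5) * exp (\<gamma> / 4 * indicator S x)" .
  qed (auto simp: weight_pos less_imp_le)
  also have "\<dots> = (1 - \<gamma> * p / 5) * ip f (\<lambda>x. f x / exp (- (\<gamma> / 4 * indicator S x)))"
    unfolding ip_def sum_distrib_left div_exp power2_eq_square by (simp only: mult_ac)
  finally show ?thesis .
qed

end

section \<open>Exponential functionals of a Markov chain\<close>

lemma markov_chain_single_event:
  assumes "markov_chain M V P \<mu> X" and "z \<in> V"
  shows "{\<omega> \<in> space M. X i \<omega> = z} \<in> sets M"
proof -
  have X: "X i \<in> measurable M (count_space V)" using assms(1) by (simp add: markov_chain_def)
  have "{\<omega> \<in> space M. X i \<omega> = z} = X i -` {z} \<inter> space M" by auto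
  also have "\<dots> \<in> sets M" using assms(2) by (intro measurable_sets[OF X]) auto
  finally show ?thesis .
qed

text \<open>Conditioning on a path is meaningful only if the path has positive probability; otherwise both
sides vanish, because the extended path is a sub-event of the original one.\<close>
lemma markov_chain_path_step:
  assumes chain: "markov_chain M V P \<mu> X" and xV: "\<And>i. i \<le> n \<Longrightarrow> x i \<in> V" and y: "y \<in> V"
  shows "\<P>(\<omega> in M. \<forall>i\<le>Suc n. X i \<omega> = (x(Suc n := y)) i)
      = \<P>(\<omega> in M. \<forall>i\<le>n. X i \<omega> = x i) * P (x n) y"
proof -
  interpret prob_space M using chain by (simp add: markov_chain_def)
  have "{\<omega> \<in> space M. \<forall>i\<in>{..n}. X i \<omega> = x i} \<in> events"
    by (intro sets.sets_Collect_finite_All markov_chain_single_event[OF chain]) (auto simp: xV)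
  then have path: "{\<omega> \<in> space M. \<forall>i\<le>n. X i \<omega> = x i} \<in> events"
    by (simp only: Ball_def atMost_iff)
  have split: "{\<omega> \<in> space M. \<forall>i\<le>Suc n. X i \<omega> = (x(Suc n := y)) i}
      = {\<omega> \<in> space M. X (Suc n) \<omega> = y \<and> (\<forall>i\<le>n. X i \<omega> = x i)}"
    by (auto simp: le_Suc_eq)
  show ?thesis
  proof (cases "\<P>(\<omega> in M. \<forall>i\<le>n. X i \<omega> = x i) > 0")
    case True
    then have "\<P>(\<omega> in M. X (Suc n) \<omega> = y \<bar> \<forall>i\<le>n. X i \<omega> = x i) = P (x n) y"
      using chain xV y unfolding markov_chain_def by blast
    then show ?thesis unfolding split using True by (simp add: cond_prob_def field_simps)
  next
    case False
    have "\<P>(\<omega> in M. X (Suc n) \<omega> = y \<and> (\<forall>i\<le>n. X i \<omega> = x i)) \<le> \<P>(\<omega> in M. \<forall>i\<le>n. X i \<omega> = x i)"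
      by (rule finite_measure_mono[OF _ path]) blast
    moreover have "\<P>(\<omega> in M. \<forall>i\<le>n. X i \<omega> = x i) = 0"
      using False by (simp only: zero_less_measure_iff not_not)
    moreover have "0 \<le> \<P>(\<omega> in M. X (Suc n) \<omega> = y \<and> (\<forall>i\<le>n. X i \<omega> = x i))" by simp
    ultimately show ?thesis unfolding split by simp
  qed
qed

text \<open>By induction on the number of remaining steps, the expectation on the event that the chain has
followed a given path up to time \<open>n\<close> factors into the probability of the path and a function of its
last point: the event is split according to the next position and the Markov property of paths is
applied. Paths of length zero then give the claim.\<close>
lemma feynman_kac_expectation:
  fixes e :: "'a \<Rightarrow> real"
  assumes chain: "markov_chain M V P \<mu> X" and fin: "finite V"
    and e: "\<And>x. 0 \<le> e x" "\<And>x. e x \<le> 1"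
  shows "(\<integral>\<omega>. (\<Prod>i\<le>t. e (X i \<omega>)) \<partial>M) = (\<Sum>x\<in>V. pmf \<mu> x * feynman_kac V P e t x)"
proof -
  interpret prob_space M using chain by (simp add: markov_chain_def)
  have X: "X i \<in> measurable M (count_space V)" for i using chain by (simp add: markov_chain_def)
  have XV: "X i \<omega> \<in> V" if "\<omega> \<in> space M" for i \<omega> using measurable_space[OF X that] by simp
  define A where "A n x = {\<omega> \<in> space M. \<forall>i\<in>{..n}. X i \<omega> = x i}" for n and x :: "nat \<Rightarrow> 'a"
  define Z where "Z n m \<omega> = (\<Prod>i=n..n + m. e (X i \<omega>))" for n m :: nat and \<omega>
  have A: "A n x \<in> events" if "\<And>i. i \<le> n \<Longrightarrow> x i \<in> V" for n x
    unfolding A_def by (intro sets.sets_Collect_finite_All markov_chain_single_event[OF chain]) (auto simp: that)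
  have e_X: "(\<lambda>\<omega>. e (X i \<omega>)) \<in> borel_measurable M" for i
    by (rule measurable_compose[OF X]) simp
  have Z: "Z n m \<in> borel_measurable M" for n m
    unfolding Z_def by (intro borel_measurable_prod e_X)
  have Z01: "0 \<le> Z n m \<omega>" "Z n m \<omega> \<le> 1" for n m \<omega>
    unfolding Z_def by (auto intro!: prod_nonneg prod_le_1 simp: e)
  have int: "integrable M (\<lambda>\<omega>. indicator (A n x) \<omega> * Z k m \<omega>)" if "\<And>i. i \<le> n \<Longrightarrow> x i \<in> V" for n x k m
  proof (rule integrable_const_bound[of _ 1])
    show "(\<lambda>\<omega>. indicator (A n x) \<omega> * Z k m \<omega>) \<in> borel_measurable M"
      by (intro borel_measurable_times borel_measurable_indicator A Z that)
  qed (simp add: Z01 indicator_def)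
  have cond: "(\<integral>\<omega>. indicator (A n x) \<omega> * Z n m \<omega> \<partial>M) = prob (A n x) * feynman_kac V P e m (x n)"
    if "\<And>i. i \<le> n \<Longrightarrow> x i \<in> V" for n m x
    using that
  proof (induction m arbitrary: n x)
    case 0
    have "(\<integral>\<omega>. indicator (A n x) \<omega> * Z n 0 \<omega> \<partial>M) = (\<integral>\<omega>. indicator (A n x) \<omega> * e (x n) \<partial>M)"
      by (intro Bochner_Integration.integral_cong refl) (auto simp: Z_def A_def indicator_def, metis atMost_iff order_refl)
    also have "\<dots> = prob (A n x) * e (x n)" using A[OF 0] by simp
    finally show ?case by simp
  next
    case (Suc m)
    let ?x = "\<lambda>y. x(Suc n := y)"
    have xV: "?x y i \<in> V" if "y \<in> V" "i \<le> Suc n" for y i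
      using that Suc.prems by (auto simp: le_Suc_eq)
    have "(\<integral>\<omega>. indicator (A n x) \<omega> * Z n (Suc m) \<omega> \<partial>M)
        = (\<integral>\<omega>. e (x n) * (\<Sum>y\<in>V. indicator (A (Suc n) (?x y)) \<omega> * Z (Suc n) m \<omega>) \<partial>M)"
    proof (intro Bochner_Integration.integral_cong refl)
      fix \<omega> assume \<omega>: "\<omega> \<in> space M"
      have ind: "indicator (A (Suc n) (?x y)) \<omega> = (if y = X (Suc n) \<omega> then indicator (A n x) \<omega> else 0 :: real)" for y
      proof -
        have "(\<forall>i\<in>{..n}. X i \<omega> = (?x y) i) \<longleftrightarrow> (\<forall>i\<in>{..n}. X i \<omega> = x i)"
          by (intro ball_cong refl) auto
        then show ?thesis using \<omega> by (auto simp: A_def indicator_def atMost_Suc)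
      qed
      have "(\<Sum>y\<in>V. indicator (A (Suc n) (?x y)) \<omega> * Z (Suc n) m \<omega>)
          = (\<Sum>y\<in>V. if y = X (Suc n) \<omega> then indicator (A n x) \<omega> * Z (Suc n) m \<omega> else 0)"
        by (intro sum.cong refl) (simp add: ind)
      also have "\<dots> = indicator (A n x) \<omega> * Z (Suc n) m \<omega>"
        using XV[OF \<omega>] by (simp add: fin)
      finally have sum: "(\<Sum>y\<in>V. indicator (A (Suc n) (?x y)) \<omega> * Z (Suc n) m \<omega>)
          = indicator (A n x) \<omega> * Z (Suc n) m \<omega>" .
      have "Z n (Suc m) \<omega> = e (X n \<omega>) * Z (Suc n) m \<omega>"
        unfolding Z_def by (simp add: prod.atLeast_Suc_atMost)
      moreover have "X n \<omega> = x n" if "\<omega> \<in> A n x" using that by (simp add: A_def)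
      ultimately show "indicator (A n x) \<omega> * Z n (Suc m) \<omega>
          = e (x n) * (\<Sum>y\<in>V. indicator (A (Suc n) (?x y)) \<omega> * Z (Suc n) m \<omega>)"
        unfolding sum by (auto simp: indicator_def)
    qed
    also have "\<dots> = e (x n) * (\<Sum>y\<in>V. \<integral>\<omega>. indicator (A (Suc n) (?x y)) \<omega> * Z (Suc n) m \<omega> \<partial>M)"
      by (subst integral_mult_right_zero, subst Bochner_Integration.integral_sum) (auto intro: int xV)
    also have "\<dots> = e (x n) * (\<Sum>y\<in>V. prob (A (Suc n) (?x y)) * feynman_kac V P e m y)"
    proof (intro arg_cong2[of _ _ _ _ "(*)"] sum.cong refl)
      fix y assume "y \<in> V"
      then show "(\<integral>\<omega>. indicator (A (Suc n) (?x y)) \<omega> * Z (Suc n) m \<omega> \<partial>M)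
          = prob (A (Suc n) (?x y)) * feynman_kac V P e m y"
        using Suc.IH[of "Suc n" "?x y", OF xV] by (simp only: fun_upd_same)
    qed
    also have "\<dots> = e (x n) * (\<Sum>y\<in>V. prob (A n x) * P (x n) y * feynman_kac V P e m y)"
    proof (intro arg_cong2[of _ _ _ _ "(*)"] sum.cong refl)
      fix y assume "y \<in> V"
      then show "prob (A (Suc n) (?x y)) = prob (A n x) * P (x n) y"
        using markov_chain_path_step[OF chain Suc.prems] by (simp only: A_def Ball_def atMost_iff)
    qed
    also have "\<dots> = prob (A n x) * feynman_kac V P e (Suc m) (x n)"
      by (simp add: kernel_op_def sum_distrib_left mult_ac)
    finally show ?case .
  qed
  have "(\<integral>\<omega>. (\<Prod>i\<le>t. e (X i \<omega>)) \<partial>M)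
      = (\<integral>\<omega>. (\<Sum>x\<in>V. indicator (A 0 (\<lambda>_. x)) \<omega> * Z 0 t \<omega>) \<partial>M)"
  proof (intro Bochner_Integration.integral_cong refl)
    fix \<omega> assume \<omega>: "\<omega> \<in> space M"
    have "(\<Sum>x\<in>V. indicator (A 0 (\<lambda>_. x)) \<omega> * Z 0 t \<omega>) = (\<Sum>x\<in>V. if x = X 0 \<omega> then Z 0 t \<omega> else 0)"
      using \<omega> by (intro sum.cong refl) (auto simp: A_def indicator_def)
    then show "(\<Prod>i\<le>t. e (X i \<omega>)) = (\<Sum>x\<in>V. indicator (A 0 (\<lambda>_. x)) \<omega> * Z 0 t \<omega>)"
      using XV[OF \<omega>] by (simp add: fin Z_def atLeast0AtMost)
  qed
  also have "\<dots> = (\<Sum>x\<in>V. prob (A 0 (\<lambda>_. x)) * feynman_kac V P e t x)"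
    by (subst Bochner_Integration.integral_sum) (auto intro!: int sum.cong simp: cond)
  also have "\<dots> = (\<Sum>x\<in>V. pmf \<mu> x * feynman_kac V P e t x)"
    using chain by (intro sum.cong refl) (simp add: A_def markov_chain_def)
  finally show ?thesis .
qed

section \<open>The lazy walk on a connected graph\<close>

lemma lazy_walk_kernel_row:
  assumes "graph G" and x: "x \<in> verts G" and d: "0 < out_degree G x"
  shows "(\<Sum>y\<in>verts G. lazy_walk_kernel G x y) = 1"
proof -
  interpret graph G by fact
  have img: "head G ` out_arcs G x = {y \<in> verts G. x \<rightarrow>\<^bsub>G\<^esub> y}"
    by (auto simp: out_arcs_def arcs_ends_conv image_iff)
  have inj: "inj_on (head G) (out_arcs G x)"
    by (auto simp: inj_on_def out_arcs_def arc_to_ends_def intro: no_multi_arcs)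
  have deg: "card {y \<in> verts G. x \<rightarrow>\<^bsub>G\<^esub> y} = out_degree G x"
    unfolding img[symmetric] out_degree_def by (rule card_image[OF inj])
  have no_loop: "\<not> x \<rightarrow>\<^bsub>G\<^esub> x" using adj_not_same by blast
  have "(\<Sum>y\<in>verts G. lazy_walk_kernel G x y)
      = (\<Sum>y\<in>verts G. (if x = y then 1 / 2 else 0) + (if x \<rightarrow>\<^bsub>G\<^esub> y then 1 / (2 * real (out_degree G x)) else 0))"
    using no_loop by (intro sum.cong refl) (auto simp: lazy_walk_kernel_def)
  also have "\<dots> = 1 / 2 + real (card {y \<in> verts G. x \<rightarrow>\<^bsub>G\<^esub> y}) * (1 / (2 * real (out_degree G x)))"
    unfolding sum.distrib using x by (simp add: sum.If_cases Int_def)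
  finally show ?thesis using d unfolding deg by simp
qed

lemma connected_graph_reachable:
  assumes "graph G" "Digraph_Component.connected G" "x \<in> verts G" "y \<in> verts G"
  shows "x \<rightarrow>\<^sup>*\<^bsub>G\<^esub> y"
proof -
  interpret graph G by fact
  from symmetric_connected_imp_strongly_connected[OF sym_arcs assms(2)]
  show ?thesis using assms(3,4) by (auto simp: strongly_connected_def)
qed

lemma connected_graph_out_degree_pos:
  assumes "graph G" "Digraph_Component.connected G" "card (verts G) \<ge> 2" and x: "x \<in> verts G"
  shows "0 < out_degree G x"
proof -
  interpret graph G by fact
  have "\<not> card (verts G) \<le> Suc 0" using assms(3) by simp
  then obtain y where y: "y \<in> verts G" "y \<noteq> x"
    unfolding card_le_Suc0_iff_eq[OF finite_verts] by metis
  with connected_graph_reachable[OF assms(1,2) x y(1)] obtain z where "x \<rightarrow>\<^bsub>G\<^esub> z"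
    by (auto elim: converse_reachable_cases)
  then have "out_arcs G x \<noteq> {}" by (auto simp: out_arcs_def arcs_ends_conv)
  moreover have "finite (out_arcs G x)" by (simp add: out_arcs_def)
  ultimately show ?thesis by (simp add: out_degree_def card_gt_0_iff)
qed

lemma lazy_walk_reversible_kernel:
  assumes "graph G" "Digraph_Component.connected G" "card (verts G) \<ge> 2"
  shows "reversible_kernel (verts G) (lazy_walk_kernel G) (\<lambda>x. real (out_degree G x))"
proof -
  interpret graph G by fact
  note deg = connected_graph_out_degree_pos[OF assms]
  have nonneg: "0 \<le> lazy_walk_kernel G x y" for x y by (simp add: lazy_walk_kernel_def)
  show ?thesis
  proof
    fix x y assume xy: "x \<in> verts G" "y \<in> verts G"
    have "x \<rightarrow>\<^bsub>G\<^esub> y \<longleftrightarrow> y \<rightarrow>\<^bsub>G\<^esub> x" using arcs_ends_symmetric[OF sym_arcs] by blast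
    then show "real (out_degree G x) * lazy_walk_kernel G x y = real (out_degree G y) * lazy_walk_kernel G y x"
      using deg[OF xy(1)] deg[OF xy(2)] by (simp add: lazy_walk_kernel_def)
    let ?R = "{(x, y). x \<in> verts G \<and> y \<in> verts G \<and> 0 < lazy_walk_kernel G x y}"
    from connected_graph_reachable[OF assms(1,2) xy] show "(x, y) \<in> ?R\<^sup>*"
    proof (induction rule: reachable_induct)
      case (step y z)
      then have "(y, z) \<in> ?R"
        using deg[of y] by (auto simp: lazy_walk_kernel_def adj_in_verts)
      with step.IH show ?case by (rule rtrancl_into_rtrancl)
    qed simp
  qed (auto simp: deg nonneg lazy_walk_kernel_row[OF assms(1)])
qed

text \<open>The degree is reversible for the walk, and every stationary distribution is proportional to it, so
the chain is reversible with respect to \<open>\<pi>\<close>, which moreover charges all vertices.\<close>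
lemma lazy_walk_chain:
  assumes "graph G" "Digraph_Component.connected G" "card (verts G) \<ge> 2"
    and stat: "stationary_distribution (verts G) (lazy_walk_kernel G) \<pi>"
  shows "lazy_reversible_chain (verts G) (lazy_walk_kernel G) (pmf \<pi>)"
proof -
  interpret D: reversible_kernel "verts G" "lazy_walk_kernel G" "\<lambda>x. real (out_degree G x)"
    by (rule lazy_walk_reversible_kernel[OF assms(1-3)])
  note deg = D.weight_pos
  have sum1: "(\<Sum>x\<in>verts G. pmf \<pi> x) = 1"
    using stat D.finite_V by (intro sum_pmf_eq_1) (auto simp: stationary_distribution_def)
  then obtain z where z: "z \<in> verts G" "pmf \<pi> z \<noteq> 0"
    by (metis sum.neutral zero_neq_one)
  define c where "c = pmf \<pi> z / real (out_degree G z)"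
  have c: "c > 0" using z deg[OF z(1)] by (simp add: c_def pmf_pos)
  have degree: "pmf \<pi> x = c * real (out_degree G x)" if x: "x \<in> verts G" for x
  proof -
    have "pmf \<pi> x / real (out_degree G x) = c"
      unfolding c_def using stat x z(1)
      by (intro D.stationary_proportional) (auto simp: stationary_distribution_def)
    then show ?thesis using deg[OF x] by (simp add: field_simps)
  qed
  show ?thesis
  proof
    fix x y assume "x \<in> verts G" "y \<in> verts G"
    then show "pmf \<pi> x * lazy_walk_kernel G x y = pmf \<pi> y * lazy_walk_kernel G y x"
      using D.reversible[of x y] by (simp add: degree)
  qed (use sum1 D.finite_V deg c D.kernel_nonneg D.row_sum D.irreducible in
      \<open>auto simp: degree lazy_walk_kernel_def[of G x x for x]\<close>)
qed

section \<open>The tail bound for the local time\<close>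

theorem proposition1p4:
  fixes G :: "('a, 'b) pre_digraph"
    and \<pi> :: "'a pmf"
    and S :: "'a set"
    and M :: "'w measure"
    and X :: "nat \<Rightarrow> 'w \<Rightarrow> 'a"
    and t :: nat
  assumes "graph G"
    and "Digraph_Component.connected G"
    and "card (verts G) \<ge> 2"
    and "stationary_distribution (verts G) (lazy_walk_kernel G) \<pi>"
    and "second_largest_eigenvalue (verts G) (lazy_walk_kernel G) \<ge> 1 / 2"
    and "S \<subseteq> verts G"
    and "markov_chain M (verts G) (lazy_walk_kernel G) \<pi> X"
  shows "\<P>(\<omega> in M. local_time X S t \<omega> \<le> real t * (measure_pmf.prob \<pi> S / 2))
         \<le> exp (- (1 / 50) * real t * (measure_pmf.prob \<pi> S / relaxation_time G))"
proof -
  interpret M: prob_space M using assms(7) by (simp add: markov_chain_def)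
  interpret lazy_reversible_chain "verts G" "lazy_walk_kernel G" "pmf \<pi>"
    by (rule lazy_walk_chain[OF assms(1-4)])
  define \<gamma> where "\<gamma> = 1 - second_largest_eigenvalue (verts G) (lazy_walk_kernel G)"
  define p where "p = measure_pmf.prob \<pi> S"
  have p: "0 \<le> p" "p \<le> 1" by (simp_all add: p_def)
  have p_sum: "p = sum (pmf \<pi>) S"
    unfolding p_def using assms(6) finite_V by (intro measure_measure_pmf_finite) (rule finite_subset)
  \<comment> \<open>division by zero gives 0, so this also covers the case \<open>\<gamma> = 0\<close>\<close>
  have rhs: "exp (- (1 / 50) * real t * (p / relaxation_time G)) = exp (- (1 / 50) * real t * (p * \<gamma>))"
    by (simp add: relaxation_time_def \<gamma>_def)
  have "\<P>(\<omega> in M. local_time X S t \<omega> \<le> real t * (p / 2)) \<le> exp (- (1 / 50) * real t * (p * \<gamma>))"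
  proof (cases "\<gamma> \<le> 0")
    case True
    then have "0 \<le> - (1 / 50) * real t * (p * \<gamma>)"
      using p by (simp add: mult_nonneg_nonpos)
    then have "1 \<le> exp (- (1 / 50) * real t * (p * \<gamma>))" by simp
    then show ?thesis by (rule order_trans[OF M.prob_le_1])
  next
    case False
    then have \<gamma>: "0 \<le> \<gamma>" "\<gamma> \<le> 1" using assms(5) by (simp_all add: \<gamma>_def)
    have \<gamma>p: "0 \<le> \<gamma> * p" "\<gamma> * p \<le> 1" using \<gamma> p by (auto intro: mult_le_one)
    \<comment> \<open>the exponent \<open>\<theta> = \<gamma> / 4\<close> costs \<open>\<theta> * p / 2 = \<gamma> * p / 8\<close> per step in Markov's inequality, less than
      the gain \<open>\<gamma> * p / 5\<close> of the decay; the difference is \<open>3 / 40\<close> of \<open>\<gamma> * p\<close>\<close>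
    define e where "e x = exp (- (\<gamma> / 4 * indicator S x))" for x
    have e: "0 < e x" "e x \<le> 1" for x using \<gamma> by (simp_all add: e_def)
    define Y where "Y \<omega> = (\<Prod>i\<le>t. e (X i \<omega>))" for \<omega>
    have Y_exp: "Y \<omega> = exp (- (\<gamma> / 4 * local_time X S t \<omega>))" for \<omega>
      unfolding Y_def e_def local_time_def by (simp add: sum_distrib_left sum_negf flip: exp_sum)
    have bound: "ip f (avg f) \<le> (1 - \<gamma> * p / 5) * ip f (\<lambda>x. f x / e x)" for f
      unfolding e_def p_sum
      using poincare_second_eigenvalue[OF assms(3)] \<gamma> assms(6)
      by (intro tilted_form_bound) (simp_all add: \<gamma>_def)
    have "(\<integral>\<omega>. Y \<omega> \<partial>M) = mean (feynman_kac (verts G) (lazy_walk_kernel G) e t)"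
      unfolding Y_def mean_def
      using e less_imp_le by (intro feynman_kac_expectation[OF assms(7) finite_V]) blast+
    also have "\<dots> \<le> (1 - \<gamma> * p / 5) ^ t"
      using \<gamma>p by (intro feynman_kac_decay e bound) simp
    also have "\<dots> \<le> exp (- (\<gamma> * p / 5)) ^ t"
      using \<gamma>p exp_ge_add_one_self[of "- (\<gamma> * p / 5)"] by (intro power_mono) auto
    finally have EY: "(\<integral>\<omega>. Y \<omega> \<partial>M) \<le> exp (- (real t * (\<gamma> * p / 5)))"
      by (simp flip: exp_of_nat_mult)
    have X: "X i \<in> measurable M (count_space (verts G))" for i
      using assms(7) by (simp add: markov_chain_def)
    have Y_meas: "Y \<in> borel_measurable M"
      unfolding Y_def by (intro borel_measurable_prod measurable_compose[OF X]) simp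
    have int_Y: "integrable M Y"
    proof (rule M.integrable_const_bound[of _ 1])
      show "AE \<omega> in M. norm (Y \<omega>) \<le> 1"
        unfolding Y_def using e by (auto intro!: prod_le_1 simp: abs_prod less_imp_le)
    qed (rule Y_meas)
    define a where "a = exp (- (\<gamma> / 4 * (real t * (p / 2))))"
    have "\<P>(\<omega> in M. local_time X S t \<omega> \<le> real t * (p / 2)) \<le> \<P>(\<omega> in M. a \<le> Y \<omega>)"
    proof (rule M.finite_measure_mono)
      show "{\<omega> \<in> space M. local_time X S t \<omega> \<le> real t * (p / 2)} \<subseteq> {\<omega> \<in> space M. a \<le> Y \<omega>}"
      proof safe
        fix \<omega> assume "local_time X S t \<omega> \<le> real t * (p / 2)"
        then have "\<gamma> / 4 * local_time X S t \<omega> \<le> \<gamma> / 4 * (real t * (p / 2))"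
          by (rule mult_left_mono) (use \<gamma> in simp)
        then show "a \<le> Y \<omega>" unfolding a_def Y_exp exp_le_cancel_iff neg_le_iff_le .
      qed
      show "{\<omega> \<in> space M. a \<le> Y \<omega>} \<in> M.events" using Y_meas by measurable
    qed
    also have "\<dots> \<le> (\<integral>\<omega>. Y \<omega> \<partial>M) / a"
      by (rule integral_Markov_inequality_measure[OF int_Y sets.empty_sets])
         (auto simp: a_def Y_exp)
    also have "\<dots> \<le> exp (- (real t * (\<gamma> * p / 5))) / a"
      using EY by (intro divide_right_mono) (simp_all add: a_def)
    also have "\<dots> = exp (- (3 / 40) * (real t * (p * \<gamma>)))"
      unfolding a_def exp_diff[symmetric] by (simp add: algebra_simps)
    also have "\<dots> \<le> exp (- (1 / 50) * real t * (p * \<gamma>))"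
      using \<gamma>p by (simp add: mult_ac) (use mult_nonneg_nonneg[of "real t" "\<gamma> * p"] in \<open>simp add: mult_ac\<close>)
    finally show ?thesis .
  qed
  then show ?thesis unfolding rhs[symmetric] by (simp only: p_def)
qed

end
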